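(* Let $X$ be a real or complex Banach space. If $x \in S_X$ is a locally uniformly nonsquare point, then $x$ is not a $\Delta$-point of $X$.
   Context: $B_X$, $S_X$ denote the closed unit ball and unit sphere of $X$. A point $x \in S_X$ is a locally uniformly nonsquare point if there exists $\delta>0$ such that $\min\{\|x+y\|,\|x-y\|\} \leq 2-\delta$ for every $y \in S_X$. For $x \in S_X$ and $\epsilon>0$ put $\Delta_\epsilon(x) = \{y \in B_X : \|x-y\| \geq 2-\epsilon\}$. A point $x \in S_X$ is a $\Delta$-point if $x \in \overline{\mathrm{conv}}\,\Delta_\epsilon(x)$ (closed convex hull) for every $\epsilon>0$. *)

theory Defs
  imports "HOL-Analysis.Analysis"
begin

text \<open>The libraries have real normed spaces only. A complex Banach space is a
  real one with a compatible complex scalar multiplication and a norm that is homogeneous over the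
  complex numbers. The notions below use only the norm and the real scalars, so they are defined
  for real normed spaces and apply to both cases; in particular closed convex hulls are with
  respect to real convex combinations.\<close>

class complex_banach = banach +
  fixes scaleC :: "complex \<Rightarrow> 'a \<Rightarrow> 'a"
  assumes scaleC_add_right: "scaleC c (x + y) = scaleC c x + scaleC c y"
    and scaleC_add_left: "scaleC (c + d) x = scaleC c x + scaleC d x"
    and scaleC_scaleC: "scaleC c (scaleC d x) = scaleC (c * d) x"
    and scaleC_of_real: "scaleC (complex_of_real r) x = scaleR r x"
    and norm_scaleC: "norm (scaleC c x) = cmod c * norm x"

instantiation complex :: complex_banach
begin

definition scaleC_complex :: "complex \<Rightarrow> complex \<Rightarrow> complex"
  where "scaleC_complex c z = c * z"

instance
  by standard (simp_all add: scaleC_complex_def algebra_simps norm_mult scaleR_conv_of_real)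

end

definition locally_uniformly_nonsquare_point :: "'a::real_normed_vector \<Rightarrow> bool" where
  "locally_uniformly_nonsquare_point x \<longleftrightarrow>
     x \<in> sphere 0 1 \<and>
     (\<exists>\<delta>>0. \<forall>y\<in>sphere 0 1. min (norm (x + y)) (norm (x - y)) \<le> 2 - \<delta>)"

definition Delta_set :: "real \<Rightarrow> 'a::real_normed_vector \<Rightarrow> 'a set" where
  "Delta_set \<epsilon> x = {y \<in> cball 0 1. norm (x - y) \<ge> 2 - \<epsilon>}"

definition Delta_point :: "'a::real_normed_vector \<Rightarrow> bool" where
  "Delta_point x \<longleftrightarrow>
     x \<in> sphere 0 1 \<and> (\<forall>\<epsilon>>0. x \<in> closure (convex hull (Delta_set \<epsilon> x)))"

end

theory Submission
  imports Defs
begin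

text \<open>If \<open>x\<close> is locally uniformly nonsquare, then every point \<open>y\<close> of the unit ball that is almost
  diametral to \<open>x\<close> satisfies \<open>\<parallel>x + y\<parallel> \<le> 2 - \<epsilon>\<close>, that is, it lies in the ball of radius \<open>2 - \<epsilon>\<close>
  around \<open>-x\<close>. This ball is closed and convex and does not contain \<open>x\<close>, which has distance 2
  from \<open>-x\<close>.\<close>

lemma Delta_set_subset_cball:
  fixes x :: "'a::real_normed_vector"
  assumes x: "norm x = 1"
    and nonsquare: "\<And>y. norm y = 1 \<Longrightarrow> min (norm (x + y)) (norm (x - y)) \<le> 2 - \<delta>"
    and \<epsilon>: "\<epsilon> < 1" "2 * \<epsilon> < \<delta>"
  shows "Delta_set \<epsilon> x \<subseteq> cball (- x) (2 - \<epsilon>)"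
proof
  fix y assume "y \<in> Delta_set \<epsilon> x"
  then have y: "norm y \<le> 1" "norm (x - y) \<ge> 2 - \<epsilon>"
    by (auto simp: Delta_set_def)
  have large: "norm y \<ge> 1 - \<epsilon>"
    using norm_triangle_ineq4[of x y] x y by linarith
  then have "y \<noteq> 0"
    using \<epsilon> by auto
  \<comment> \<open>Nonsquareness concerns unit vectors only, so \<open>y\<close> is replaced by its
    normalization \<open>sgn y\<close>, which is \<open>1 - norm y\<close> away.\<close>
  have "y - sgn y = (norm y - 1) *\<^sub>R sgn y"
    using \<open>y \<noteq> 0\<close> by (simp add: sgn_div_norm algebra_simps)
  then have close: "norm (y - sgn y) \<le> \<epsilon>"
    using \<open>y \<noteq> 0\<close> y large by (simp add: norm_sgn)
  have "norm (x - y) \<le> norm (x - sgn y) + norm (y - sgn y)"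
    using norm_triangle_ineq4[of "x - sgn y" "y - sgn y"] by simp
  \<comment> \<open>This norm is at least \<open>2 - 2 * \<epsilon>\<close>, so the minimum in
    \<open>nonsquare\<close> can only be small through its other term.\<close>
  then have "norm (x - sgn y) > 2 - \<delta>"
    using y close \<epsilon> by linarith
  then have "norm (x + sgn y) \<le> 2 - \<delta>"
    using nonsquare[of "sgn y"] \<open>y \<noteq> 0\<close> by (simp add: norm_sgn min_le_iff_disj)
  moreover have "norm (x + y) \<le> norm (x + sgn y) + norm (y - sgn y)"
    using norm_triangle_ineq[of "x + sgn y" "y - sgn y"] by simp
  \<comment> \<open>Undoing the normalization costs another \<epsilon>, and
    \<open>2 - \<delta> + \<epsilon> < 2 - \<epsilon>\<close>.\<close>
  ultimately have "norm (x + y) \<le> 2 - \<epsilon>"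
    using close \<epsilon> by linarith
  then show "y \<in> cball (- x) (2 - \<epsilon>)"
    by (simp add: dist_norm norm_minus_commute add.commute)
qed

lemma locally_uniformly_nonsquare_imp_not_Delta_point:
  fixes x :: "'a::real_normed_vector"
  assumes "locally_uniformly_nonsquare_point x"
  shows "\<not> Delta_point x"
proof
  assume Delta: "Delta_point x"
  obtain \<delta> where x: "norm x = 1" and "\<delta> > 0"
    and nonsquare: "\<And>y. norm y = 1 \<Longrightarrow> min (norm (x + y)) (norm (x - y)) \<le> 2 - \<delta>"
    using assms by (auto simp: locally_uniformly_nonsquare_point_def)
  \<comment> \<open>The factor 3 leaves room for two errors of size \<epsilon> below \<delta>; the
    cap at 1 keeps \<open>Delta_set \<epsilon> x\<close> away from 0.\<close>
  define \<epsilon> where "\<epsilon> = min 1 \<delta> / 3"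
  have \<epsilon>: "\<epsilon> > 0" "\<epsilon> < 1" "2 * \<epsilon> < \<delta>"
    using \<open>\<delta> > 0\<close> by (auto simp: \<epsilon>_def)
  have "closure (convex hull (Delta_set \<epsilon> x)) \<subseteq> cball (- x) (2 - \<epsilon>)"
    by (intro closure_minimal hull_minimal Delta_set_subset_cball[OF x nonsquare]
        \<epsilon> convex_cball closed_cball)
  with Delta \<epsilon> have "x \<in> cball (- x) (2 - \<epsilon>)"
    by (auto simp: Delta_point_def)
  moreover have "dist (- x) x = 2"
    using x norm_scaleR[of "-2" x] by (simp add: dist_norm scaleR_2)
  ultimately show False
    using \<epsilon> by simp
qed

theorem proposition3p4:
  fixes x :: "'a::banach" and z :: "'b::complex_banach"
  shows "(x \<in> sphere 0 1 \<and> locally_uniformly_nonsquare_point x \<longrightarrow> \<not> Delta_point x) \<and>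
         (z \<in> sphere 0 1 \<and> locally_uniformly_nonsquare_point z \<longrightarrow> \<not> Delta_point z)"
  \<comment> \<open>Both conjuncts are instances of the real lemma, since
    \<open>complex_banach\<close> extends \<open>banach\<close>.\<close>
  by (simp add: locally_uniformly_nonsquare_imp_not_Delta_point)

end
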